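(* Let $\Gamma,\sigma_1,\sigma_2>0$ be constants and let $(h,\alpha,k,K)$ be an admissible reward structure. Consider the two-armed diffusive evolutions $$dX^{(1)}_t=\sigma_1\,dW^{(1)}_t,\qquad dX^{(2)}_t=\sigma_2\sqrt{2\Gamma}\,\tanh\!\left[\frac{\sqrt{2\Gamma}}{\sigma_2}X^{(2)}_t\right]dt+\sigma_2\,dW^{(2)}_t,$$ where $W^{(1)},W^{(2)}$ are independent Wiener processes, with corresponding Gittins indices $M^{(1)}$ and $M^{(2)}$ given by $$M^{(1)}(x)=\frac1\alpha\int_0^\infty h\!\left(x+\frac{\sigma_1 z}{\sqrt{2\alpha}}\right)e^{-z}\,dz,$$ $$M^{(2)}(x)=\rho_-(x)S_-(x)+\rho_+(x)S_+(x),$$ where $$\rho_\pm(x)=\frac{2}{2\alpha+\sigma_2^2(B\pm A)^2e^{\pm2Ax}},\quad S_\pm(x)=\int_0^\infty h\!\left(x+\frac{s}{B\pm A}\right)e^{-s}\,ds,\quad A=\frac{\sqrt{2\Gamma}}{\sigma_2},\quad B=\frac{\sqrt{2(\alpha+\Gamma)}}{\sigma_2}.$$ Assume that $$\sqrt{1+\frac{\Gamma}{\alpha}}-\sqrt{\frac{\Gamma}{\alpha}}<\frac{\sigma_2}{\sigma_1}<\sqrt{1+\frac{\Gamma}{\alpha}}+\sqrt{\frac{\Gamma}{\alpha}}.$$ Then there exist two thresholds $x_+,x_-\in\mathbb{R}$ such that $$x>x_+\ \Rightarrow\ M^{(1)}(x)<M^{(2)}(x),\qquad x<x_-\ \Rightarrow\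 M^{(1)}(x)>M^{(2)}(x).$$
   Context: Admissible reward structure: a 4-tuple $(h,\alpha,k,K)$ where $\alpha>0$ (the discounting factor) and $h:\mathbb{R}\to[\alpha k,\alpha K]$ is a strictly increasing function with bounded first and second derivatives such that $\lim_{x\to-\infty}h(x)=\alpha k$, $\lim_{x\to+\infty}h(x)=\alpha K$ and $\lim_{|x|\to\infty}|h'(x)|=0$. Gittins index of a diffusion $X$: $M(x)=\sup_\tau\frac{\mathbb{E}_x\int_0^\tau h(X_s)e^{-\alpha s}ds}{1-\mathbb{E}_xe^{-\alpha\tau}}$, the supremum being over stopping times and $\mathbb{E}_x$ being the expectation for the process started at $x$. For the purposes of this statement, $M^{(1)}$ and $M^{(2)}$ are the functions given by the explicit formulas in the claim. *)

theory Defs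
  imports "HOL-Analysis.Analysis"
begin

definition admissible_reward :: "(real \<Rightarrow> real) \<Rightarrow> real \<Rightarrow> real \<Rightarrow> real \<Rightarrow> bool" where
  "admissible_reward h \<alpha> k K \<longleftrightarrow>
     \<alpha> > 0 \<and>
     range h \<subseteq> {\<alpha> * k .. \<alpha> * K} \<and>
     strict_mono h \<and>
     (\<forall>x. h differentiable at x) \<and>
     (\<forall>x. deriv h differentiable at x) \<and>
     bounded (range (deriv h)) \<and>
     bounded (range (deriv (deriv h))) \<and>
     (h \<longlongrightarrow> \<alpha> * k) at_bot \<and>
     (h \<longlongrightarrow> \<alpha> * K) at_top \<and>
     ((\<lambda>x. \<bar>deriv h x\<bar>) \<longlongrightarrow> 0) at_infinity"

text \<open>Gittins index of the driftless arm \<open>dX = \<sigma>\<^sub>1 dW\<close>, in closed form.\<close>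

definition M1 :: "(real \<Rightarrow> real) \<Rightarrow> real \<Rightarrow> real \<Rightarrow> real \<Rightarrow> real" where
  "M1 h \<alpha> \<sigma>\<^sub>1 x =
     1 / \<alpha> * (LBINT z:{0..}. h (x + \<sigma>\<^sub>1 * z / sqrt (2 * \<alpha>)) * exp (- z))"

definition coeff_A :: "real \<Rightarrow> real \<Rightarrow> real" where
  "coeff_A \<Gamma> \<sigma>\<^sub>2 = sqrt (2 * \<Gamma>) / \<sigma>\<^sub>2"

definition coeff_B :: "real \<Rightarrow> real \<Rightarrow> real \<Rightarrow> real" where
  "coeff_B \<alpha> \<Gamma> \<sigma>\<^sub>2 = sqrt (2 * (\<alpha> + \<Gamma>)) / \<sigma>\<^sub>2"

definition rho_plus :: "real \<Rightarrow> real \<Rightarrow> real \<Rightarrow> real \<Rightarrow> real" where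
  "rho_plus \<alpha> \<Gamma> \<sigma>\<^sub>2 x =
     (let A = coeff_A \<Gamma> \<sigma>\<^sub>2; B = coeff_B \<alpha> \<Gamma> \<sigma>\<^sub>2
      in 2 / (2 * \<alpha> + \<sigma>\<^sub>2\<^sup>2 * (B + A)\<^sup>2 * exp (2 * A * x)))"

definition rho_minus :: "real \<Rightarrow> real \<Rightarrow> real \<Rightarrow> real \<Rightarrow> real" where
  "rho_minus \<alpha> \<Gamma> \<sigma>\<^sub>2 x =
     (let A = coeff_A \<Gamma> \<sigma>\<^sub>2; B = coeff_B \<alpha> \<Gamma> \<sigma>\<^sub>2
      in 2 / (2 * \<alpha> + \<sigma>\<^sub>2\<^sup>2 * (B - A)\<^sup>2 * exp (- 2 * A * x)))"

definition S_plus :: "(real \<Rightarrow> real) \<Rightarrow> real \<Rightarrow> real \<Rightarrow> real \<Rightarrow> real \<Rightarrow> real" where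
  "S_plus h \<alpha> \<Gamma> \<sigma>\<^sub>2 x =
     (let A = coeff_A \<Gamma> \<sigma>\<^sub>2; B = coeff_B \<alpha> \<Gamma> \<sigma>\<^sub>2
      in LBINT s:{0..}. h (x + s / (B + A)) * exp (- s))"

definition S_minus :: "(real \<Rightarrow> real) \<Rightarrow> real \<Rightarrow> real \<Rightarrow> real \<Rightarrow> real \<Rightarrow> real" where
  "S_minus h \<alpha> \<Gamma> \<sigma>\<^sub>2 x =
     (let A = coeff_A \<Gamma> \<sigma>\<^sub>2; B = coeff_B \<alpha> \<Gamma> \<sigma>\<^sub>2
      in LBINT s:{0..}. h (x + s / (B - A)) * exp (- s))"

text \<open>Gittins index of the arm \<open>dX = \<sigma>\<^sub>2 sqrt (2\<Gamma>) tanh (sqrt (2\<Gamma>) X / \<sigma>\<^sub>2) dt + \<sigma>\<^sub>2 dW\<close>,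
  in closed form.\<close>

definition M2 :: "(real \<Rightarrow> real) \<Rightarrow> real \<Rightarrow> real \<Rightarrow> real \<Rightarrow> real \<Rightarrow> real" where
  "M2 h \<alpha> \<Gamma> \<sigma>\<^sub>2 x =
     rho_minus \<alpha> \<Gamma> \<sigma>\<^sub>2 x * S_minus h \<alpha> \<Gamma> \<sigma>\<^sub>2 x + rho_plus \<alpha> \<Gamma> \<sigma>\<^sub>2 x * S_plus h \<alpha> \<Gamma> \<sigma>\<^sub>2 x"

end

(* With P = B - A, Q = sqrt (2 alpha) / sigma_1, R = B + A the hypothesis on sigma_2 / sigma_1 says
   P < Q < R, and alpha M1 = F(Q), alpha M2 = w F(P) + (1 - w) F(R), where w = alpha rho_minus is a
   logistic weight with w -> 1 at +infinity and w <= (R/P) exp((R - P) x), and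
     F(p) = \<integral> h(x + s/p) exp(-s) ds = h(x) + \<integral> h'(x + t) exp(-p t) dt.
   F is strictly decreasing and convex in p, so F(Q) <= (1 - l) F(P) + l F(R) with
   l = (Q - P)/(R - P) > 0; once 1 - w < l this gives M1 < M2.
   At -infinity alpha (M1 - M2) is the integral of h'(x + t) against the kernel
   exp(-Q t) - w exp(-P t) - (1 - w) exp(-R t).  It is positive for t <= 1 - x, where the increase of
   h on [0, 1] contributes at least c exp(Q x); beyond that it is at least -w exp(-P t), and this
   tail contributes at least -O(exp((R - P) x) exp(P x)) = -O(exp(R x)), which is negligible
   because Q < R. *)

theory Submission
  imports Defs
begin

section \<open>Exponential integrals and inequalities\<close>

lemma set_integrable_exp_atLeast:
  fixes p a :: real
  assumes "p > 0"
  shows "set_integrable lborel {a..} (\<lambda>t. exp (- p * t))"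
    and "(LBINT t:{a..}. exp (- p * t)) = exp (- p * a) / p"
proof -
  have "(\<lambda>t. exp (- p * t)) absolutely_integrable_on {a..}"
    by (intro nonnegative_absolutely_integrable_1 integrable_on_exp_minus_to_infinity assms) auto
  then show *: "set_integrable lborel {a..} (\<lambda>t. exp (- p * t))"
    \<comment> \<open>Absolute integrability refers to the completed measure; the integrand is
      Borel, so the claim descends to \<open>lborel\<close>.\<close>
    unfolding set_integrable_def by (subst (asm) integrable_completion) auto
  show "(LBINT t:{a..}. exp (- p * t)) = exp (- p * a) / p"
    using set_borel_integral_eq_integral(2)[OF *] has_integral_exp_minus_to_infinity[OF assms, of a]
    by (auto simp: integral_unique)
qed

lemma set_integrable_bounded_times_exp:
  fixes f :: "real \<Rightarrow> real"
  assumes "p > 0" and [measurable]: "f \<in> borel_measurable borel"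
    and C: "\<And>t. t \<ge> a \<Longrightarrow> \<bar>f t\<bar> \<le> C"
  shows "set_integrable lborel {a..} (\<lambda>t. f t * exp (- p * t))"
proof (rule set_integrable_bound)
  show "set_integrable lborel {a..} (\<lambda>t. C * exp (- p * t))"
    using set_integrable_exp_atLeast(1)[OF assms(1)] by simp
  show "set_borel_measurable lborel {a..} (\<lambda>t. f t * exp (- p * t))"
    unfolding set_borel_measurable_def by measurable
  show "AE t in lborel. t \<in> {a..} \<longrightarrow> norm (f t * exp (- p * t)) \<le> norm (C * exp (- p * t))"
    using C by (intro AE_I2) (force simp: abs_mult intro!: mult_right_mono)
qed

text \<open>The proof is \<open>exp y \<ge> 1 + y\<close> at \<open>y = u t\<close> and \<open>y = - (v - u) t\<close>: with weights
  \<open>v - u\<close> and \<open>u\<close> the linear terms cancel.\<close>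
lemma exp_minus_one_ratio:
  fixes u v t :: real
  assumes "0 < u" "u \<le> v"
  shows "u / v * exp (- (v - u) * t) * (exp (v * t) - 1) \<le> exp (u * t) - 1"
proof -
  have "v = (v - u) * (1 + u * t) + u * (1 + - (v - u) * t)"
    by (simp add: algebra_simps)
  also have "\<dots> \<le> (v - u) * exp (u * t) + u * exp (- (v - u) * t)"
    using assms by (intro add_mono mult_left_mono exp_ge_add_one_self) auto
  finally have "u * (exp (u * t) - exp (- (v - u) * t)) \<le> v * (exp (u * t) - 1)"
    by (simp add: algebra_simps)
  moreover have "exp (- (v - u) * t) * (exp (v * t) - 1) = exp (u * t) - exp (- (v - u) * t)"
    by (simp add: algebra_simps flip: exp_add)
  ultimately show ?thesis
    using assms by (simp add: field_simps)
qed

text \<open>\<open>Q\<close> is the convex combination of \<open>P\<close> and \<open>R\<close> with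
  weight \<open>(Q - P) / (R - P)\<close> on \<open>R\<close>, so convexity of \<open>exp\<close>
  applies.\<close>

lemma exp_minus_convex:
  fixes P Q R t :: real
  assumes "P < Q" "Q < R"
  shows "exp (- Q * t) \<le> (1 - (Q - P) / (R - P)) * exp (- P * t) + (Q - P) / (R - P) * exp (- R * t)"
proof -
  define l where "l = (Q - P) / (R - P)"
  have l: "0 \<le> l" "l \<le> 1" and "l * (R - P) = Q - P"
    using assms by (auto simp: l_def field_simps)
  then have Q: "Q = P + l * (R - P)"
    by simp
  have "exp ((1 - l) * (- P * t) + l * (- R * t)) \<le> (1 - l) * exp (- P * t) + l * exp (- R * t)"
    using convex_onD[OF exp_convex, of l "- P * t" "- R * t"] l by simp
  moreover have "- Q * t = (1 - l) * (- P * t) + l * (- R * t)"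
    unfolding Q by (simp add: algebra_simps)
  ultimately show ?thesis
    unfolding l_def by simp
qed

lemma eventually_exp_less_at_bot:
  fixes c \<epsilon> :: real
  assumes "c > 0" "\<epsilon> > 0"
  shows "eventually (\<lambda>x. exp (c * x) < \<epsilon>) at_bot"
proof -
  have "eventually (\<lambda>x. x < ln \<epsilon> / c) at_bot"
    by (rule eventually_gt_at_bot)
  then show ?thesis
  proof eventually_elim
    case (elim x)
    then have "c * x < ln \<epsilon>"
      using assms(1) by (simp add: field_simps)
    then show ?case
      using assms(2) by (metis exp_less_cancel_iff exp_ln)
  qed
qed

section \<open>Exponential averages of a bounded increasing function\<close>

text \<open>An upper bound on \<open>\<phi>\<close> suffices for a two-sided one, since monotonicity
  of \<open>h\<close> makes its derivative nonnegative.\<close>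

locale smooth_increasing =
  fixes h \<phi> :: "real \<Rightarrow> real" and C H :: real
  assumes deriv: "\<And>x. (h has_real_derivative \<phi> x) (at x)"
    and cont: "continuous_on UNIV \<phi>"
    and h_bound: "\<And>x. \<bar>h x\<bar> \<le> C"
    and phi_bound: "\<And>x. \<phi> x \<le> H"
    and smono: "strict_mono h"
begin

text \<open>For positive \<open>p\<close>, this is the mean of \<open>h\<close> at \<open>x\<close>
  plus an exponential variable of rate \<open>p\<close>, the common shape of the integrals in
  \<open>M1\<close>, \<open>S_minus\<close> and \<open>S_plus\<close>.\<close>

definition avg :: "real \<Rightarrow> real \<Rightarrow> real" where
  "avg p x = (LBINT s:{0..}. h (x + s / p) * exp (- s))"

definition lap :: "real \<Rightarrow> real \<Rightarrow> real" where
  "lap p x = (LBINT t:{0..}. \<phi> (x + t) * exp (- p * t))"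

lemma phi_nonneg: "0 \<le> \<phi> x"
proof -
  have "mono_on UNIV h"
    using smono by (simp add: strict_mono_mono)
  then show ?thesis
    using deriv by (intro mono_on_imp_deriv_nonneg[of UNIV h]) auto
qed

lemma phi_abs_bound: "\<bar>\<phi> x\<bar> \<le> H"
  using phi_nonneg[of x] phi_bound[of x] by simp

lemma deriv_shift: "((\<lambda>t. h (x + t)) has_real_derivative \<phi> (x + t)) (at t)"
  using DERIV_shift[THEN iffD1, OF deriv[of "t + x"]] by (simp add: add.commute)

lemma phi_shift_cont: "continuous_on S (\<lambda>t. \<phi> (x + t))"
  by (rule continuous_on_compose2[OF cont]) (auto intro: continuous_intros)

lemma isCont_shift: "isCont (\<lambda>t. h (x + t)) t" "isCont (\<lambda>t. \<phi> (x + t)) t"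
  using deriv_shift[THEN DERIV_isCont] phi_shift_cont[of UNIV x]
  by (simp_all add: continuous_on_eq_continuous_at)

lemma H_nonneg: "0 \<le> H"
  using phi_nonneg[of 0] phi_bound[of 0] by simp

lemma h_cont: "continuous_on UNIV h"
  using deriv by (meson DERIV_continuous continuous_at_imp_continuous_on)

lemma measurable_phi [measurable]: "\<phi> \<in> borel_measurable borel"
  using cont by (rule borel_measurable_continuous_onI)

lemma measurable_h [measurable]: "h \<in> borel_measurable borel"
  using h_cont by (rule borel_measurable_continuous_onI)

lemma set_integrable_phi:
  "p > 0 \<Longrightarrow> set_integrable lborel {0..} (\<lambda>t. \<phi> (x + t) * exp (- p * t))"
  by (rule set_integrable_bounded_times_exp[where C=H]) (auto simp: phi_abs_bound)

lemma set_integrable_h: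
  "p > 0 \<Longrightarrow> set_integrable lborel {0..} (\<lambda>t. h (x + t) * exp (- p * t))"
  by (rule set_integrable_bounded_times_exp[where C=C]) (auto simp: h_bound)

text \<open>Substitution \<open>s = p * t\<close>, then integration by parts; boundedness of
  \<open>h\<close> kills the boundary term at infinity. All dependence on \<open>p\<close> now sits
  in a kernel against the nonnegative \<open>\<phi>\<close>, and the term \<open>h x\<close> cancels
  when averages are compared.\<close>

lemma avg_eq:
  assumes "p > 0"
  shows "avg p x = h x + lap p x"
proof -
  let ?f = "\<lambda>t. p * (h (x + t) * exp (- p * t)) - \<phi> (x + t) * exp (- p * t)"
  \<comment> \<open>\<open>?f\<close> is the derivative of \<open>?F\<close>, so the difference to
    be computed is a telescoping integral.\<close>
  let ?F = "\<lambda>t. - (h (x + t) * exp (- p * t))"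
  have "avg p x = (LBINT s. indicator {0..} s * (h (x + s / p) * exp (- s)))"
    by (simp add: avg_def set_lebesgue_integral_def)
  also have "\<dots> = p * (LBINT t. indicator {0..} (p * t) * (h (x + p * t / p) * exp (- (p * t))))"
    using lborel_integral_real_affine[of p "\<lambda>s. indicator {0..} s * (h (x + s / p) * exp (- s))" 0] assms
    by simp
  also have "\<dots> = p * (LBINT t:{0..}. h (x + t) * exp (- p * t))"
    using assms unfolding set_lebesgue_integral_def
    by (intro arg_cong[where f="\<lambda>y. p * y"] Bochner_Integration.integral_cong)
       (auto split: split_indicator simp: zero_le_mult_iff)
  finally have avg: "avg p x = p * (LBINT t:{0..}. h (x + t) * exp (- p * t))" .
  have int: "set_integrable lborel {0..} ?f"
    using set_integrable_phi[OF assms] set_integrable_h[OF assms] by (intro set_integral_diff) auto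
  have "avg p x - lap p x = (LBINT t:{0..}. ?f t)"
    using set_integrable_phi[OF assms, of x] set_integrable_h[OF assms, of x]
    by (simp add: avg lap_def set_integral_diff)
  \<comment> \<open>Interval integrals range over open intervals; the removed point 0 is a null
    set.\<close>
  also have "\<dots> = (LBINT t:{0<..}. ?f t)"
  proof (rule set_integral_cong_set)
    show "AE t in lborel. (t \<in> {0<..}) = (t \<in> {0::real..})"
      using AE_lborel_singleton[of 0] by eventually_elim auto
  qed (auto simp: set_borel_measurable_def)
  also have "\<dots> = (LBINT t=0..\<infinity>. ?f t)"
    unfolding zero_ereal_def by (rule interval_integral_to_infinity_eq[symmetric])
  also have "\<dots> = 0 - (- h x)"
  proof (rule interval_integral_FTC_integrable)
    show "(?F has_vector_derivative ?f t) (at t)" for t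
      unfolding has_real_derivative_iff_has_vector_derivative[symmetric]
      by (rule derivative_eq_intros deriv_shift refl)+ (simp add: algebra_simps)
    show "isCont ?f t" for t
      by (intro continuous_intros isCont_shift)
    show "set_integrable lborel (einterval 0 \<infinity>) ?f"
      using int by (rule set_integrable_subset) (auto simp: einterval_def)
    show "((?F \<circ> real_of_ereal) \<longlongrightarrow> - h x) (at_right 0)"
      proof -
      have "isCont ?F 0"
        by (intro continuous_intros isCont_shift)
      then have "(?F \<longlongrightarrow> ?F 0) (at_right 0)"
        by (simp add: continuous_within filterlim_at_split)
      then show ?thesis
        unfolding zero_ereal_def ereal_tendsto_simps by simp
    qed
    show "((?F \<circ> real_of_ereal) \<longlongrightarrow> 0) (at_left \<infinity>)"
      proof -
      have "LIM t at_top. p * t :> at_top"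
        using assms by (intro filterlim_tendsto_pos_mult_at_top[OF tendsto_const]) (auto simp: filterlim_ident)
      then have "LIM t at_top. - (p * t) :> at_bot"
        by (simp add: filterlim_uminus_at_top)
      then have "((\<lambda>t. exp (- p * t)) \<longlongrightarrow> 0) at_top"
        unfolding mult_minus_left by (rule filterlim_compose[OF exp_at_bot])
      then have "(?F \<longlongrightarrow> 0) at_top"
        by (rule Lim_null_comparison[rotated, OF tendsto_mult_right_zero[of _ _ C]])
           (auto simp: abs_mult intro!: always_eventually mult_right_mono h_bound)
      then show ?thesis
        unfolding ereal_tendsto_simps .
    qed
  qed simp
  finally show ?thesis by simp
qed

text \<open>On the window from \<open>a\<close> to \<open>a + 1\<close> the weight
  \<open>\<phi>\<close> integrates to an increment of \<open>h\<close>, which is the gain; the loss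
  is bounded by replacing \<open>\<phi>\<close> with \<open>H\<close>. Before \<open>a\<close> the
  hypothesis on \<open>\<kappa>\<close> just says that it is nonnegative.\<close>

lemma lap_kernel_lower_bound:
  assumes kint: "set_integrable lborel {0..} (\<lambda>t. \<phi> (x + t) * \<kappa> t)"
    and "p > 0" "0 \<le> c" "0 \<le> d" "0 \<le> a"
    and \<kappa>: "\<And>t. 0 \<le> t \<Longrightarrow> c * indicator {a..a + 1} t - d * exp (- p * t) * indicator {a..} t \<le> \<kappa> t"
  shows "c * (h (x + a + 1) - h (x + a)) - d * H * exp (- p * a) / p \<le> (LBINT t:{0..}. \<phi> (x + t) * \<kappa> t)"
proof -
  have i1: "set_integrable lborel {a..a + 1} (\<lambda>t. \<phi> (x + t))"
    by (intro borel_integrable_atLeastAtMost' phi_shift_cont)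
  have i2: "set_integrable lborel {a..} (\<lambda>t. exp (- p * t))"
    by (rule set_integrable_exp_atLeast) fact
  have "(LBINT t:{a..a + 1}. \<phi> (x + t)) = h (x + (a + 1)) - h (x + a)"
    unfolding set_lebesgue_integral_def
  proof (rule integral_FTC_Icc)
    show "((\<lambda>t. h (x + t)) has_vector_derivative \<phi> (x + t)) (at t within {a..a + 1})" for t
      unfolding has_real_derivative_iff_has_vector_derivative[symmetric]
      by (rule has_field_derivative_at_within[OF deriv_shift])
  qed (use phi_shift_cont in auto)
  moreover have "(LBINT t:{a..}. exp (- p * t)) = exp (- p * a) / p"
    by (rule set_integrable_exp_atLeast) fact
  ultimately have "c * (h (x + a + 1) - h (x + a)) - d * H * exp (- p * a) / p
     = c * (LBINT t:{a..a + 1}. \<phi> (x + t)) - d * H * (LBINT t:{a..}. exp (- p * t))"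
    by (simp add: add.assoc)
  also have "\<dots> = (LBINT t. c * (indicator {a..a + 1} t * \<phi> (x + t)) - d * H * (indicator {a..} t * exp (- p * t)))"
    using i1 i2 by (simp add: set_lebesgue_integral_def set_integrable_def)
  also have "\<dots> \<le> (LBINT t:{0..}. \<phi> (x + t) * \<kappa> t)"
    unfolding set_lebesgue_integral_def
  proof (rule integral_mono)
    show "integrable lborel (\<lambda>t. c * (indicator {a..a + 1} t * \<phi> (x + t)) - d * H * (indicator {a..} t * exp (- p * t)))"
      using i1 i2 by (simp add: set_integrable_def)
    show "integrable lborel (\<lambda>t. indicator {0..} t *\<^sub>R (\<phi> (x + t) * \<kappa> t))"
      using kint by (simp add: set_integrable_def)
    fix t :: real
    show "c * (indicator {a..a + 1} t * \<phi> (x + t)) - d * H * (indicator {a..} t * exp (- p * t))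
            \<le> indicator {0..} t *\<^sub>R (\<phi> (x + t) * \<kappa> t)"
    proof (cases "0 \<le> t")
      case True
      have "d * exp (- p * t) * indicator {a..} t * \<phi> (x + t) \<le> d * exp (- p * t) * indicator {a..} t * H"
        using phi_bound \<open>0 \<le> d\<close> by (intro mult_left_mono) auto
      then have "c * (indicator {a..a + 1} t * \<phi> (x + t)) - d * H * (indicator {a..} t * exp (- p * t))
        \<le> \<phi> (x + t) * (c * indicator {a..a + 1} t - d * exp (- p * t) * indicator {a..} t)"
        by (simp add: algebra_simps)
      also have "\<dots> \<le> \<phi> (x + t) * \<kappa> t"
        using \<kappa>[OF True] phi_nonneg by (rule mult_left_mono)
      finally show ?thesis
        using True by simp
    next
      case False
      then show ?thesis
        using \<open>0 \<le> a\<close> by simp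
    qed
  qed
  finally show ?thesis .
qed

text \<open>The difference of the kernels is nonnegative, and bounded away from 0 on a window where
  \<open>h\<close> strictly increases.\<close>

lemma lap_strict_antimono:
  assumes "0 < P" "P < R"
  shows "lap R x < lap P x"
proof -
  \<comment> \<open>A lower bound for \<open>?\<kappa>\<close> on [1, 2]: the first factor is least
    at 2, the second at 1. Starting the window at 1 avoids the zero of \<open>?\<kappa>\<close> at
    0.\<close>
  let ?c = "exp (- (2 * P)) * (1 - exp (- (R - P)))"
  let ?\<kappa> = "\<lambda>t. exp (- P * t) - exp (- R * t)"
  have fact: "?\<kappa> t = exp (- (P * t)) * (1 - exp (- ((R - P) * t)))" for t
    by (simp add: algebra_simps flip: exp_add)
  have int: "set_integrable lborel {0..} (\<lambda>t. \<phi> (x + t) * exp (- P * t))"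
      "set_integrable lborel {0..} (\<lambda>t. \<phi> (x + t) * exp (- R * t))"
    by (rule set_integrable_phi, use assms in linarith)+
  have "?c * (h (x + 1 + 1) - h (x + 1)) - 0 * H * exp (- P * 1) / P \<le> (LBINT t:{0..}. \<phi> (x + t) * ?\<kappa> t)"
  proof (rule lap_kernel_lower_bound)
    show "set_integrable lborel {0..} (\<lambda>t. \<phi> (x + t) * ?\<kappa> t)"
      using int by (simp add: right_diff_distrib set_integral_diff)
    fix t :: real assume t: "0 \<le> t"
    have "?c \<le> ?\<kappa> t" if "t \<in> {1..1 + 1}"
    proof -
      have "(R - P) * 1 \<le> (R - P) * t"
        using that assms by (intro mult_left_mono) auto
      then have "exp (- ((R - P) * t)) \<le> exp (- (R - P))"
        by (simp add: algebra_simps)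
      then show ?thesis
        unfolding fact using that assms by (intro mult_mono) (auto simp del: exp_le_cancel_iff)
    qed
    moreover have "0 \<le> ?\<kappa> t"
      using t assms by (simp add: mult_right_mono)
    ultimately show "?c * indicator {1..1 + 1} t - 0 * exp (- P * t) * indicator {1..} t \<le> ?\<kappa> t"
      by (auto split: split_indicator)
  qed (use assms in auto)
  moreover have "0 < ?c * (h (x + 1 + 1) - h (x + 1))"
    using assms strict_monoD[OF smono, of "x + 1" "x + 1 + 1"] by simp
  moreover have "(LBINT t:{0..}. \<phi> (x + t) * ?\<kappa> t) = lap P x - lap R x"
    using int by (simp add: right_diff_distrib set_integral_diff lap_def)
  ultimately show ?thesis
    by simp
qed

text \<open>Integrates \<open>exp_minus_convex\<close> against the nonnegative
  \<open>\<phi>\<close>.\<close>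

lemma lap_convex:
  assumes "0 < P" "P < Q" "Q < R"
  shows "lap Q x \<le> (1 - (Q - P) / (R - P)) * lap P x + (Q - P) / (R - P) * lap R x"
proof -
  let ?l = "(Q - P) / (R - P)"
  have int: "set_integrable lborel {0..} (\<lambda>t. \<phi> (x + t) * exp (- P * t))"
      "set_integrable lborel {0..} (\<lambda>t. \<phi> (x + t) * exp (- Q * t))"
      "set_integrable lborel {0..} (\<lambda>t. \<phi> (x + t) * exp (- R * t))"
    by (rule set_integrable_phi, use assms in linarith)+
  have "lap Q x \<le> (LBINT t:{0..}. (1 - ?l) * (\<phi> (x + t) * exp (- P * t)) + ?l * (\<phi> (x + t) * exp (- R * t)))"
    unfolding lap_def
  proof (rule set_integral_mono)
    fix t :: real
    have "\<phi> (x + t) * exp (- Q * t) \<le> \<phi> (x + t) * ((1 - ?l) * exp (- P * t) + ?l * exp (- R * t))"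
      using phi_nonneg exp_minus_convex assms by (intro mult_left_mono) auto
    then show "\<phi> (x + t) * exp (- Q * t) \<le> (1 - ?l) * (\<phi> (x + t) * exp (- P * t)) + ?l * (\<phi> (x + t) * exp (- R * t))"
      by (simp only: distrib_left mult.left_commute)
  qed (use int in \<open>auto intro!: set_integral_add\<close>)
  also have "\<dots> = (1 - ?l) * lap P x + ?l * lap R x"
    using int by (simp add: set_integral_add lap_def)
  finally show ?thesis .
qed

section \<open>Comparison of the averages near both infinities\<close>

text \<open>Convexity bounds \<open>lap Q x\<close> by the mixture with weight \<open>1 - ?l\<close>
  on \<open>P\<close>. Raising this weight to \<open>w x\<close> strictly increases the mixture,
  because \<open>lap R x < lap P x\<close>.\<close>

lemma avg_less_at_top:
  assumes "0 < P" "P < Q" "Q < R" and w: "(w \<longlongrightarrow> 1) at_top"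
  shows "eventually (\<lambda>x. avg Q x < w x * avg P x + (1 - w x) * avg R x) at_top"
proof -
  let ?l = "(Q - P) / (R - P)"
  have "eventually (\<lambda>x. 1 - ?l < w x) at_top"
    using assms by (intro order_tendstoD(1)[OF w]) auto
  then show ?thesis
  proof eventually_elim
    case (elim x)
    have "0 < (w x - (1 - ?l)) * (lap P x - lap R x)"
      using elim assms lap_strict_antimono[of P R x] by simp
    moreover have "w x * lap P x + (1 - w x) * lap R x
      = (1 - ?l) * lap P x + ?l * lap R x + (w x - (1 - ?l)) * (lap P x - lap R x)"
      by (simp add: algebra_simps)
    ultimately have "lap Q x < w x * lap P x + (1 - w x) * lap R x"
      using lap_convex[of P Q R x] assms by linarith
    then show ?case
      using assms by (simp add: avg_eq algebra_simps)
  qed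
qed

lemma avg_greater_at_bot:
  assumes PQR: "0 < P" "P < Q" "Q < R" and "0 < D"
    and w: "\<And>x. 0 \<le> w x" "\<And>x. w x \<le> D * exp ((R - P) * x)"
  shows "eventually (\<lambda>x. w x * avg P x + (1 - w x) * avg R x < avg Q x) at_bot"
proof -
  \<comment> \<open>Factoring \<open>exp (- R * t)\<close> out of the kernel leaves
    \<open>exp (u * t) - 1 - w x * (exp (v * t) - 1)\<close>.\<close>
  define u v where "u = R - Q" and "v = R - P"
  have uv: "0 < u" "u < v"
    using PQR by (auto simp: u_def v_def)
  \<comment> \<open>Chosen so that \<open>c * exp (Q * x)\<close> bounds half of
    \<open>exp (- Q * t) - exp (- R * t)\<close> from below on the window from \<open>- x\<close> to
    \<open>1 - x\<close>, where \<open>t\<close> exceeds 1.\<close>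
  define c where "c = exp (- Q) * (1 - exp (- u)) / 2"
  have c: "0 < c"
    using uv by (simp add: c_def)
  have h01: "0 < h 1 - h 0"
    using strict_monoD[OF smono, of 0 1] by simp
  \<comment> \<open>This threshold keeps the kernel positive up to \<open>1 - x\<close>, with half
    of its main term to spare.\<close>
  have "eventually (\<lambda>x. exp (u * x) < u / v * exp (- (v - u)) / (2 * D)) at_bot"
    using uv \<open>0 < D\<close> by (intro eventually_exp_less_at_bot) auto
  \<comment> \<open>This one makes the tail smaller than the gain; \<open>H + 1\<close> keeps the
    denominator positive even when \<open>H\<close> is 0.\<close>
  moreover have "eventually (\<lambda>x. exp (u * x) < c * (h 1 - h 0) * P / (D * (H + 1))) at_bot"
    using uv \<open>0 < D\<close> c h01 PQR H_nonneg by (intro eventually_exp_less_at_bot divide_pos_pos mult_pos_pos) auto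
  moreover have "eventually (\<lambda>x::real. x < - 1) at_bot"
    by (rule eventually_gt_at_bot)
  ultimately show ?thesis
  proof eventually_elim
    case (elim x)
    let ?\<kappa> = "\<lambda>t. exp (- Q * t) - (w x * exp (- P * t) + (1 - w x) * exp (- R * t))"
    have int: "set_integrable lborel {0..} (\<lambda>t. \<phi> (x + t) * exp (- P * t))"
        "set_integrable lborel {0..} (\<lambda>t. \<phi> (x + t) * exp (- Q * t))"
        "set_integrable lborel {0..} (\<lambda>t. \<phi> (x + t) * exp (- R * t))"
      by (rule set_integrable_phi, use PQR in linarith)+
    have \<kappa>_split: "\<phi> (x + t) * ?\<kappa> t = \<phi> (x + t) * exp (- Q * t) -
        (w x * (\<phi> (x + t) * exp (- P * t)) + (1 - w x) * (\<phi> (x + t) * exp (- R * t)))" for t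
      by (simp add: algebra_simps)
    \<comment> \<open>The factor \<open>exp (u * x)\<close> supplies the smallness; the rest matches
      the decay in \<open>exp_minus_one_ratio\<close> at \<open>t = 1 - x\<close>, the worst point
      of the range.\<close>
    have "D * exp (v * x) = D * exp (u * x) * exp ((v - u) * x)"
      by (simp add: algebra_simps flip: exp_add)
    also have "\<dots> \<le> (u / v * exp (- (v - u)) / 2) * exp ((v - u) * x)"
    proof (rule mult_right_mono)
      show "D * exp (u * x) \<le> u / v * exp (- (v - u)) / 2"
        using mult_left_mono[OF less_imp_le[OF elim(1)], of D] \<open>0 < D\<close> by simp
    qed simp
    also have "\<dots> = u / v * exp (- (v - u) * (1 - x)) / 2"
      by (simp add: algebra_simps flip: exp_add)
    finally have w_small: "w x \<le> u / v * exp (- (v - u) * (1 - x)) / 2"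
      using w(2)[of x] by (simp add: v_def)
    have half: "(exp (- Q * t) - exp (- R * t)) / 2 \<le> ?\<kappa> t" if "0 \<le> t" "t \<le> 1 - x" for t
    proof -
      have "u / v * exp (- (v - u) * (1 - x)) \<le> u / v * exp (- (v - u) * t)"
        using that uv by (intro mult_left_mono) auto
      then have "w x \<le> u / v * exp (- (v - u) * t) / 2"
        by (intro order_trans[OF w_small] divide_right_mono) auto
      then have "w x * (exp (v * t) - 1) \<le> u / v * exp (- (v - u) * t) / 2 * (exp (v * t) - 1)"
        using that uv by (intro mult_right_mono) auto
      also have "\<dots> \<le> (exp (u * t) - 1) / 2"
        using exp_minus_one_ratio[of u v t] uv by simp
      finally have "exp (- R * t) * (w x * (exp (v * t) - 1)) \<le> exp (- R * t) * ((exp (u * t) - 1) / 2)"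
        by (intro mult_left_mono) auto
      moreover have "exp (- R * t) * exp (v * t) = exp (- P * t)"
        "exp (- R * t) * exp (u * t) = exp (- Q * t)"
        by (simp_all add: u_def v_def algebra_simps flip: exp_add)
      ultimately show ?thesis
        by (simp add: field_simps)
    qed
    \<comment> \<open>With \<open>a = - x\<close> the window always sees the same increment
      \<open>h 1 - h 0\<close>, whatever \<open>x\<close> is.\<close>
    have "c * exp (Q * x) * (h (x + - x + 1) - h (x + - x)) - w x * H * exp (- P * - x) / P
        \<le> (LBINT t:{0..}. \<phi> (x + t) * ?\<kappa> t)"
    proof (rule lap_kernel_lower_bound)
      show "set_integrable lborel {0..} (\<lambda>t. \<phi> (x + t) * ?\<kappa> t)"
        unfolding \<kappa>_split using int by (auto intro!: set_integral_diff set_integral_add)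
      fix t :: real assume t: "0 \<le> t"
      have QR: "exp (- R * t) \<le> exp (- Q * t)"
        using t PQR by (simp add: mult_right_mono)
      have wP: "0 \<le> w x * exp (- P * t)"
        using w(1) by simp
      consider "t < - x" | "- x \<le> t" "t \<le> - x + 1" | "- x + 1 < t"
        by linarith
      then show "c * exp (Q * x) * indicator {- x..- x + 1} t - w x * exp (- P * t) * indicator {- x..} t \<le> ?\<kappa> t"
      proof cases
        case 1
        moreover have "0 \<le> ?\<kappa> t"
          by (rule order_trans[OF _ half]) (use 1 t QR in auto)
        ultimately show ?thesis
          by simp
      next
        case 2
        have "c * exp (Q * x) = exp (- Q * (1 - x)) * (1 - exp (- u)) / 2"
          by (simp add: c_def algebra_simps flip: exp_add)
        also have "\<dots> \<le> exp (- Q * t) * (1 - exp (- u * t)) / 2"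
          using 2 PQR uv elim(3) by (intro divide_right_mono mult_mono) auto
        also have "\<dots> = (exp (- Q * t) - exp (- R * t)) / 2"
          by (simp add: u_def algebra_simps flip: exp_add)
        finally show ?thesis
          using half[of t] t 2 wP by simp
      next
        case 3
        moreover have "0 \<le> w x * exp (- R * t)"
          using w(1) by simp
        then have "- (w x * exp (- P * t)) \<le> ?\<kappa> t"
          using QR by (simp only: left_diff_distrib mult_1)
        ultimately show ?thesis
          by simp
      qed
    qed (use PQR c w(1) elim(3) in auto)
    moreover have "w x * H * exp (- P * - x) / P < c * exp (Q * x) * (h 1 - h 0)"
    proof -
      have "w x * H \<le> D * exp (v * x) * (H + 1)"
        using w(2)[of x] \<open>0 < D\<close> H_nonneg by (intro mult_mono) (auto simp: v_def)
      then have "w x * H * exp (P * x) \<le> D * exp (v * x) * (H + 1) * exp (P * x)"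
        by (intro mult_right_mono) auto
      \<comment> \<open>Both \<open>v + P\<close> and \<open>u + Q\<close> equal \<open>R\<close>:
        the tail has order \<open>exp (R * x)\<close>, smaller than the gain by the factor
        \<open>exp (u * x)\<close>.\<close>
      also have "\<dots> = D * (H + 1) * exp (u * x) * exp (Q * x)"
        by (simp add: u_def v_def algebra_simps flip: exp_add)
      also have "\<dots> < c * (h 1 - h 0) * P * exp (Q * x)"
      proof (rule mult_strict_right_mono)
        have "0 < D * (H + 1)"
          using \<open>0 < D\<close> H_nonneg by simp
        then show "D * (H + 1) * exp (u * x) < c * (h 1 - h 0) * P"
          using elim(2) by (simp only: pos_less_divide_eq mult.commute)
      qed simp
      finally show ?thesis
        using PQR by (simp add: field_simps)
    qed
    moreover have "(LBINT t:{0..}. \<phi> (x + t) * ?\<kappa> t) = lap Q x - (w x * lap P x + (1 - w x) * lap R x)"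
      unfolding \<kappa>_split using int by (simp add: set_integral_diff set_integral_add lap_def)
    ultimately show ?case
      using PQR by (simp add: avg_eq algebra_simps)
  qed
qed

end

section \<open>Reduction of the two indices to averages\<close>

lemma admissible_reward_smooth_increasing:
  assumes "admissible_reward h \<alpha> k K"
  obtains C H where "smooth_increasing h (deriv h) C H"
proof -
  note adm = assms[unfolded admissible_reward_def]
  obtain H where H: "\<And>x. \<bar>deriv h x\<bar> \<le> H"
    using adm by (auto simp: bounded_iff)
  have "smooth_increasing h (deriv h) (max \<bar>\<alpha> * k\<bar> \<bar>\<alpha> * K\<bar>) H"
  proof
    show "(h has_real_derivative deriv h x) (at x)" for x
      using adm DERIV_deriv_iff_real_differentiable by blast
    show "continuous_on UNIV (deriv h)"
      using adm differentiable_imp_continuous_within[of "deriv h"]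
      by (auto simp: continuous_on_eq_continuous_within)
    show "deriv h x \<le> H" for x
      using H[of x] by simp
    show "\<bar>h x\<bar> \<le> max \<bar>\<alpha> * k\<bar> \<bar>\<alpha> * K\<bar>" for x
    proof -
      have "h x \<in> {\<alpha> * k..\<alpha> * K}"
        using adm by blast
      then show ?thesis
        by auto
    qed
  qed (use adm in auto)
  then show thesis
    by (rule that)
qed

theorem theorem4p1:
  fixes \<Gamma> \<sigma>\<^sub>1 \<sigma>\<^sub>2 \<alpha> k K :: real and h :: "real \<Rightarrow> real"
  assumes "\<Gamma> > 0" and "\<sigma>\<^sub>1 > 0" and "\<sigma>\<^sub>2 > 0"
    and "admissible_reward h \<alpha> k K"
    and "sqrt (1 + \<Gamma> / \<alpha>) - sqrt (\<Gamma> / \<alpha>) < \<sigma>\<^sub>2 / \<sigma>\<^sub>1"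
    and "\<sigma>\<^sub>2 / \<sigma>\<^sub>1 < sqrt (1 + \<Gamma> / \<alpha>) + sqrt (\<Gamma> / \<alpha>)"
  shows "\<exists>x_plus x_minus :: real.
           (\<forall>x. x > x_plus \<longrightarrow> M1 h \<alpha> \<sigma>\<^sub>1 x < M2 h \<alpha> \<Gamma> \<sigma>\<^sub>2 x) \<and>
           (\<forall>x. x < x_minus \<longrightarrow> M1 h \<alpha> \<sigma>\<^sub>1 x > M2 h \<alpha> \<Gamma> \<sigma>\<^sub>2 x)"
proof -
  have \<alpha>: "\<alpha> > 0"
    using assms(4) by (simp add: admissible_reward_def)
  obtain C H where "smooth_increasing h (deriv h) C H"
    using admissible_reward_smooth_increasing[OF assms(4)] .
  then interpret smooth_increasing h "deriv h" C H .
  define A B where "A = coeff_A \<Gamma> \<sigma>\<^sub>2" and "B = coeff_B \<alpha> \<Gamma> \<sigma>\<^sub>2"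
  define P Q R where "P = B - A" and "Q = sqrt (2 * \<alpha>) / \<sigma>\<^sub>1" and "R = B + A"
  \<comment> \<open>This is \<open>\<alpha>\<close> times \<open>rho_minus\<close> with common
    factors cancelled; \<open>R - P\<close> is \<open>2 * A\<close>, the rate in the original
    exponentials.\<close>
  define w where "w = (\<lambda>x. R / (R + P * exp (- (R - P) * x)))"
  have A0: "0 < A"
    using assms by (simp add: A_def coeff_A_def)
  have "A < B"
    using assms \<alpha> by (simp add: A_def B_def coeff_A_def coeff_B_def divide_strict_right_mono)
  then have P0: "0 < P" and PR: "P < R"
    using A0 by (auto simp: P_def R_def)
  have sq: "\<sigma>\<^sub>2\<^sup>2 * A\<^sup>2 = 2 * \<Gamma>" "\<sigma>\<^sub>2\<^sup>2 * B\<^sup>2 = 2 * (\<alpha> + \<Gamma>)"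
    using assms \<alpha> by (simp_all add: A_def B_def coeff_A_def coeff_B_def power_divide)
  \<comment> \<open>\<open>P * R\<close> is the difference of the squares of \<open>B\<close> and
    \<open>A\<close>, where \<Gamma> cancels. Substituted for \<open>2 * \<alpha>\<close>, it lets
    the denominators of both coefficients factor.\<close>
  have PR_eq: "\<sigma>\<^sub>2\<^sup>2 * (P * R) = 2 * \<alpha>"
    using sq by (simp add: P_def R_def algebra_simps power2_eq_square)
  \<comment> \<open>Multiplied by \<open>sqrt (2 * \<alpha>)\<close>, the two hypotheses on the
    ratio of volatilities become \<open>P < Q\<close> and \<open>Q < R\<close>, up to the factor
    \<open>\<sigma>\<^sub>2\<close>.\<close>
  have scaled: "sqrt (2 * \<alpha>) * sqrt (1 + \<Gamma> / \<alpha>) = \<sigma>\<^sub>2 * B" "sqrt (2 * \<alpha>) * sqrt (\<Gamma> / \<alpha>) = \<sigma>\<^sub>2 * A"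
    using \<alpha> assms by (simp_all add: A_def B_def coeff_A_def coeff_B_def algebra_simps flip: real_sqrt_mult)
  have "sqrt (2 * \<alpha>) * (sqrt (1 + \<Gamma> / \<alpha>) - sqrt (\<Gamma> / \<alpha>)) < sqrt (2 * \<alpha>) * (\<sigma>\<^sub>2 / \<sigma>\<^sub>1)"
    using assms(5) \<alpha> by (intro mult_strict_left_mono) auto
  then have "\<sigma>\<^sub>2 * P < \<sigma>\<^sub>2 * Q"
    unfolding right_diff_distrib scaled by (simp add: right_diff_distrib P_def Q_def mult.commute)
  then have PQ: "P < Q"
    using assms(3) by simp
  have "sqrt (2 * \<alpha>) * (\<sigma>\<^sub>2 / \<sigma>\<^sub>1) < sqrt (2 * \<alpha>) * (sqrt (1 + \<Gamma> / \<alpha>) + sqrt (\<Gamma> / \<alpha>))"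
    using assms(6) \<alpha> by (intro mult_strict_left_mono) auto
  then have "\<sigma>\<^sub>2 * Q < \<sigma>\<^sub>2 * R"
    unfolding distrib_left scaled by (simp add: distrib_left R_def Q_def mult.commute)
  then have QR: "Q < R"
    using assms(3) by simp
  have M1: "M1 h \<alpha> \<sigma>\<^sub>1 x = avg Q x / \<alpha>" for x
    by (simp add: M1_def avg_def Q_def mult.commute)
  have rho_minus: "rho_minus \<alpha> \<Gamma> \<sigma>\<^sub>2 x = w x / \<alpha>" for x
  proof -
    have "rho_minus \<alpha> \<Gamma> \<sigma>\<^sub>2 x = 2 / (\<sigma>\<^sub>2\<^sup>2 * P * (R + P * exp (- (R - P) * x)))"
      unfolding rho_minus_def Let_def A_def[symmetric] B_def[symmetric] P_def[symmetric] PR_eq[symmetric]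
      by (simp add: P_def R_def algebra_simps power2_eq_square)
    also have "\<dots> = 2 * R / (\<sigma>\<^sub>2\<^sup>2 * (P * R) * (R + P * exp (- (R - P) * x)))"
      using P0 PR by simp
    also have "\<dots> = w x / \<alpha>"
      unfolding PR_eq w_def using \<alpha> by simp
    finally show ?thesis .
  qed
  have rho_plus: "rho_plus \<alpha> \<Gamma> \<sigma>\<^sub>2 x = (1 - w x) / \<alpha>" for x
  proof -
    have pos: "0 < R + P * exp (- (R - P) * x)" "0 < P + R * exp ((R - P) * x)"
      using P0 PR by (auto intro!: add_pos_pos)
    have "rho_plus \<alpha> \<Gamma> \<sigma>\<^sub>2 x = 2 / (\<sigma>\<^sub>2\<^sup>2 * R * (P + R * exp ((R - P) * x)))"
      unfolding rho_plus_def Let_def A_def[symmetric] B_def[symmetric] R_def[symmetric] PR_eq[symmetric]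
      by (simp add: P_def R_def algebra_simps power2_eq_square)
    also have "\<dots> = 2 * P / (\<sigma>\<^sub>2\<^sup>2 * (P * R) * (P + R * exp ((R - P) * x)))"
      using P0 PR by simp
    also have "\<dots> = P / (P + R * exp ((R - P) * x)) / \<alpha>"
      unfolding PR_eq using \<alpha> by simp
    \<comment> \<open>Expanding the fraction \<open>1 - w x\<close> by
      \<open>exp ((R - P) * x)\<close> gives the left side, so the two coefficients add up to
      \<open>1 / \<alpha>\<close>.\<close>
    also have "P / (P + R * exp ((R - P) * x)) = 1 - w x"
    proof -
      have e: "exp (- (R - P) * x) * exp ((R - P) * x) = 1"
        by (simp add: algebra_simps flip: exp_add)
      show ?thesis
        using pos e by (simp add: w_def divide_simps) (simp add: algebra_simps)
    qed
    finally show ?thesis .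
  qed
  have M2: "M2 h \<alpha> \<Gamma> \<sigma>\<^sub>2 x = (w x * avg P x + (1 - w x) * avg R x) / \<alpha>" for x
    unfolding M2_def rho_minus rho_plus
    by (simp add: S_minus_def S_plus_def avg_def Let_def P_def R_def A_def B_def add_divide_distrib)
  \<comment> \<open>The limit 1 is written in the unevaluated shape that the limit rules
    produce.\<close>
  have "(w \<longlongrightarrow> R / (R + P * 0)) at_top"
    unfolding w_def
  proof (intro tendsto_intros)
    have "LIM x at_top. (R - P) * x :> at_top"
      using PR by (intro filterlim_tendsto_pos_mult_at_top[OF tendsto_const]) (auto simp: filterlim_ident)
    then have "LIM x at_top. - ((R - P) * x) :> at_bot"
      by (simp add: filterlim_uminus_at_top)
    then show "((\<lambda>x. exp (- (R - P) * x)) \<longlongrightarrow> 0) at_top"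
      unfolding mult_minus_left by (rule filterlim_compose[OF exp_at_bot])
  qed (use P0 PR in auto)
  then have "(w \<longlongrightarrow> 1) at_top"
    using P0 PR by simp
  then have top: "eventually (\<lambda>x. avg Q x < w x * avg P x + (1 - w x) * avg R x) at_top"
    using P0 PQ QR by (intro avg_less_at_top)
  have bot: "eventually (\<lambda>x. w x * avg P x + (1 - w x) * avg R x < avg Q x) at_bot"
  proof (rule avg_greater_at_bot[OF P0 PQ QR, where D="R / P"])
    show "0 < R / P" "\<And>x. 0 \<le> w x"
      using P0 PR by (auto simp: w_def)
    show "w x \<le> R / P * exp ((R - P) * x)" for x
    proof -
      \<comment> \<open>Dropping \<open>R\<close> from the denominator leaves a pure exponential,
        whence \<open>D = R / P\<close>.\<close>
      have "w x \<le> R / (P * exp (- (R - P) * x))"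
        unfolding w_def using P0 PR by (intro divide_left_mono) (auto intro!: mult_pos_pos add_pos_pos)
      then show ?thesis
        by (simp only: mult_minus_left exp_minus) (simp add: field_simps)
    qed
  qed
  obtain x_plus where "\<And>x. x > x_plus \<Longrightarrow> avg Q x < w x * avg P x + (1 - w x) * avg R x"
    using top by (meson eventually_at_top_linorder order.strict_implies_order)
  moreover obtain x_minus where "\<And>x. x < x_minus \<Longrightarrow> w x * avg P x + (1 - w x) * avg R x < avg Q x"
    using bot by (meson eventually_at_bot_linorder order.strict_implies_order)
  ultimately show ?thesis
    unfolding M1 M2 using \<alpha> by (meson divide_strict_right_mono)
qed

end
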